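(* Let $X$ be a real Hilbert space, let $A, B\colon X\rightrightarrows X$ be maximally monotone, and set $\widetilde{T}=R_BR_A$. Let $\mathsf v=P_{\overline{\operatorname{ran}}(\mathrm{Id}-T)}(0)$, where $T=\tfrac12(\mathrm{Id}+R_BR_A)$, and let $Z=\{x\in X : 0\in -\mathsf v+Ax+B(x-\mathsf v)\}$. Suppose that $Z\neq\varnothing$ and that $A$ is uniformly monotone with a supercoercive modulus. Then there exists $\overline{x}\in X$ such that $Z=\{\overline{x}\}$. Moreover, for every $x\in X$, $J_A\widetilde{T}^n x\to\overline{x}$ in norm as $n\to\infty$.
   Context: For a maximally monotone operator $C\colon X\rightrightarrows X$: $J_C=(\mathrm{Id}+C)^{-1}$ is the resolvent (single-valued with full domain) and $R_C=2J_C-\mathrm{Id}$ is the reflected resolvent. The set $\overline{\operatorname{ran}}(\mathrm{Id}-T)$ is the closure of the range of $\mathrm{Id}-T$; it is nonempty, closed and convex, and $P_D$ denotes the metric projection onto a nonempty closed convex set $D$, so $\mathsf v$ is the element of minimal norm in $\overline{\operatorname{ran}}(\mathrm{Id}-T)$. $A$ is uniformly monotone with modulus $\phi\colon \mathbb{R}_+\to[0,+\infty]$ if $\phi$ is increasing, vanishes only at $0$, and $\langle x-y,x^*-y^*\rangle\ge\phi(\|x-y\|)$ for all $(x,x^* ),(y,y^* )$ in the graph of $A$. The modulus $\phi$ is supercoercive if $\phi(t)/t\to+\infty$ as $t\to+\infty$. *)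

theory Defs
  imports "HOL-Analysis.Analysis" "HOL-Library.Set_Algebras" "HOL-Library.Extended_Real"
begin

text \<open>A set-valued operator on \<open>X\<close> is a function \<open>X \<Rightarrow> X set\<close>; sums of operators are
  pointwise Minkowski sums as in \<^theory>\<open>HOL-Library.Set_Algebras\<close>.\<close>

definition graph :: "('a \<Rightarrow> 'a set) \<Rightarrow> ('a \<times> 'a) set" where
  "graph A = {(x, u). u \<in> A x}"

definition monotone_op :: "('a::real_inner \<Rightarrow> 'a set) \<Rightarrow> bool" where
  "monotone_op A \<longleftrightarrow> (\<forall>(x, u) \<in> graph A. \<forall>(y, w) \<in> graph A. 0 \<le> (x - y) \<bullet> (u - w))"

definition maximally_monotone :: "('a::real_inner \<Rightarrow> 'a set) \<Rightarrow> bool" where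
  "maximally_monotone A \<longleftrightarrow>
     monotone_op A \<and> (\<forall>B. monotone_op B \<and> graph A \<subseteq> graph B \<longrightarrow> graph B = graph A)"

text \<open>Only the values on \<open>{0..}\<close> matter. "Increasing" is meant in the non-strict sense.\<close>

definition modulus :: "(real \<Rightarrow> ereal) \<Rightarrow> bool" where
  "modulus \<phi> \<longleftrightarrow>
     (\<forall>t\<ge>0. 0 \<le> \<phi> t) \<and> mono_on {0..} \<phi> \<and> (\<forall>t\<ge>0. \<phi> t = 0 \<longleftrightarrow> t = 0)"

definition uniformly_monotone_with ::
  "(real \<Rightarrow> ereal) \<Rightarrow> ('a::real_inner \<Rightarrow> 'a set) \<Rightarrow> bool" where
  "uniformly_monotone_with \<phi> A \<longleftrightarrow> modulus \<phi> \<and>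
     (\<forall>(x, u) \<in> graph A. \<forall>(y, w) \<in> graph A. ereal ((x - y) \<bullet> (u - w)) \<ge> \<phi> (norm (x - y)))"

definition supercoercive :: "(real \<Rightarrow> ereal) \<Rightarrow> bool" where
  "supercoercive \<phi> \<longleftrightarrow> ((\<lambda>t. \<phi> t / ereal t) \<longlongrightarrow> \<infinity>) at_top"

text \<open>The resolvent is \<open>(Id + C)\<inverse>\<close>; the description is proper when that inverse
  is single-valued with full domain, as it is for maximally monotone \<open>C\<close> on a Hilbert space.\<close>

definition resolvent :: "('a::real_inner \<Rightarrow> 'a set) \<Rightarrow> 'a \<Rightarrow> 'a" where
  "resolvent C x = (THE y. x \<in> {y} + C y)"

definition reflected_resolvent :: "('a::real_inner \<Rightarrow> 'a set) \<Rightarrow> 'a \<Rightarrow> 'a" where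
  "reflected_resolvent C x = 2 *\<^sub>R resolvent C x - x"

text \<open>The library's \<open>closest_point\<close> is restricted to Heine-Borel spaces, hence not available
  in infinite dimensions. The description is proper for nonempty closed convex \<open>D\<close> in a
  Hilbert space.\<close>

definition metric_projection :: "'a::real_inner set \<Rightarrow> 'a \<Rightarrow> 'a" where
  "metric_projection D x = (THE p. p \<in> D \<and> (\<forall>y\<in>D. dist x p \<le> dist x y))"

end

theory Submission
  imports Defs
begin

text \<open>Minty's surjectivity theorem makes the resolvents everywhere defined: the graph of a
  monotone operator, lifted by \<open>(y, w) \<mapsto> ((y - w) / 2, y \<bullet> w)\<close>, has a convex hull on which
  \<open>(c, s) \<mapsto> s + |c|\<^sup>2\<close> is nonnegative, and the first component of its minimiser over the closure solves \<open>0 \<in> x + A x\<close>.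

  If \<open>z \<in> Z\<close>, say \<open>v = a + b\<close> with \<open>a \<in> A z\<close> and \<open>b \<in> B (z - v)\<close>, then \<open>w = z + a\<close>
  realises the minimal displacement of \<open>T\<close>, so minimality forces its orbit under \<open>R\<^sub>B R\<^sub>A\<close> to be
  \<open>w - 2 n v\<close>; every point of it is sent into \<open>Z\<close> by \<open>J\<^sub>A\<close>, and \<open>Z\<close> is a singleton by
  uniform monotonicity. Along any other orbit the squared distance to this one drops at each
  step by at least \<open>4 \<phi> (|J\<^sub>A y\<^sub>n - z|)\<close>, which therefore tends to \<open>0\<close>.\<close>

text \<open>The right-hand side of \<open>le\<close> tends to \<open>2 m + 2 m - 4 m = 0\<close>. In
  both uses \<open>le\<close> comes from the parallelogram law and a lower bound for
  midpoints.\<close>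

lemma Cauchy_of_dist_sq_le:
  fixes c :: "nat \<Rightarrow> 'a::real_normed_vector"
  assumes h: "h \<longlonglongrightarrow> (m::real)"
    and le: "\<And>i j. (norm (c i - c j))\<^sup>2 \<le> 2 * h i + 2 * h j - 4 * m"
  shows "Cauchy c"
proof (rule CauchyI)
  fix e :: real assume e: "0 < e"
  then have "0 < e\<^sup>2 / 4" by simp
  then obtain N where N: "\<And>n. n \<ge> N \<Longrightarrow> \<bar>h n - m\<bar> < e\<^sup>2 / 4"
    using LIMSEQ_D[OF h] by (metis real_norm_def)
  have "norm (c i - c j) < e" if "i \<ge> N" "j \<ge> N" for i j
  proof -
    have "(norm (c i - c j))\<^sup>2 < e\<^sup>2"
      using le[of i j] N[OF that(1), unfolded abs_less_iff] N[OF that(2), unfolded abs_less_iff]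
      by (simp add: field_simps)
    then show ?thesis using e by (simp add: power_less_imp_less_base)
  qed
  then show "\<exists>M. \<forall>m\<ge>M. \<forall>n\<ge>M. norm (c m - c n) < e" by blast
qed

lemma minimising_sequence:
  fixes f :: "'b \<Rightarrow> real"
  assumes "K \<noteq> {}" "bdd_below (f ` K)"
  obtains p where "\<And>n. p n \<in> K" "(\<lambda>n. f (p n)) \<longlonglongrightarrow> Inf (f ` K)"
proof -
  have "Inf (f ` K) \<in> closure (f ` K)"
    using assms by (intro closure_contains_Inf) auto
  then obtain q where q: "\<And>n. q n \<in> f ` K" "q \<longlonglongrightarrow> Inf (f ` K)"
    unfolding closure_sequential by blast
  have "\<forall>n. \<exists>x. x \<in> K \<and> f x = q n" using q(1) by (metis imageE)
  then obtain p where "\<And>n. p n \<in> K" "\<And>n. f (p n) = q n" by metis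
  then show thesis using q(2) by (intro that[of p]) simp_all
qed

section \<open>Minty's theorem\<close>

text \<open>First-order optimality for \<open>f (c, s) = s + |c|\<^sup>2\<close> at
  \<open>(x, m - |x|\<^sup>2)\<close>, a limit of a minimising sequence that need not lie in
  \<open>K\<close>. The infimum \<open>m\<close> is nonnegative and is dropped at the end.\<close>

lemma convex_min_norm_sq_variational:
  fixes K :: "('a::{real_inner, complete_space} \<times> real) set"
  assumes cvx: "convex K" and ne: "K \<noteq> {}"
    and nonneg: "\<And>c s. (c, s) \<in> K \<Longrightarrow> 0 \<le> s + (norm c)\<^sup>2"
  shows "\<exists>x. \<forall>(c, s) \<in> K. 0 \<le> s + 2 * (x \<bullet> c) - (norm x)\<^sup>2"
proof -
  define f :: "'a \<times> real \<Rightarrow> real" where "f = (\<lambda>(c, s). s + (norm c)\<^sup>2)"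
  define m where "m = Inf (f ` K)"
  have bdd: "bdd_below (f ` K)"
    by (rule bdd_belowI[of _ 0]) (auto simp: f_def nonneg)
  have m_le: "m \<le> s + (norm c)\<^sup>2" if "(c, s) \<in> K" for c s
    using cINF_lower[OF bdd that] by (simp add: m_def f_def)
  have m_nonneg: "0 \<le> m"
    unfolding m_def using ne by (intro cINF_greatest) (auto simp: f_def nonneg)
  obtain p where pK: "\<And>n. p n \<in> K" and plim: "(\<lambda>n. f (p n)) \<longlonglongrightarrow> m"
    using minimising_sequence[OF ne bdd] unfolding m_def by blast
  define c where "c n = fst (p n)" for n
  define s where "s n = snd (p n)" for n
  have K: "(c n, s n) \<in> K" for n using pK by (simp add: c_def s_def)
  have lim: "(\<lambda>n. s n + (norm (c n))\<^sup>2) \<longlonglongrightarrow> m"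
    using plim by (simp add: f_def c_def s_def case_prod_beta)
  have "(norm (c i - c j))\<^sup>2
      \<le> 2 * (s i + (norm (c i))\<^sup>2) + 2 * (s j + (norm (c j))\<^sup>2) - 4 * m" for i j
  proof -
    have "(1/2) *\<^sub>R (c i, s i) + (1/2) *\<^sub>R (c j, s j) \<in> K"
      using convexD[OF cvx K K, of "1/2" "1/2"] by simp
    then have "((1/2) *\<^sub>R (c i + c j), (s i + s j) / 2) \<in> K"
      by (simp add: scaleR_add_right add_divide_distrib)
    from m_le[OF this] have "4 * m \<le> 2 * (s i + s j) + 4 * (norm ((1/2) *\<^sub>R (c i + c j)))\<^sup>2"
      by (simp only: field_simps) simp
    moreover have "4 * (norm ((1/2) *\<^sub>R (c i + c j)))\<^sup>2
        = 2 * (norm (c i))\<^sup>2 + 2 * (norm (c j))\<^sup>2 - (norm (c i - c j))\<^sup>2"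
      unfolding power2_norm_eq_inner by (simp add: inner_diff inner_add inner_commute)
    ultimately show ?thesis by simp
  qed
  then have "Cauchy c" by (rule Cauchy_of_dist_sq_le[OF lim])
  then obtain x where x: "c \<longlonglongrightarrow> x"
    using Cauchy_convergent convergent_def by blast
  have "(\<lambda>n. (s n + (norm (c n))\<^sup>2) - (norm (c n))\<^sup>2) \<longlonglongrightarrow> m - (norm x)\<^sup>2"
    by (intro tendsto_intros lim x)
  then have s: "s \<longlonglongrightarrow> m - (norm x)\<^sup>2" by simp
  have "0 \<le> r + 2 * (x \<bullet> d) - (norm x)\<^sup>2" if dK: "(d, r) \<in> K" for d r
  proof -
    \<comment> \<open>\<open>q\<close> is the derivative of \<open>f\<close> at the limit point in
      the direction of \<open>(d, r)\<close>. Minimality along the segment, divided by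
      \<open>t\<close> and sent to \<open>t = 0\<close>, makes it nonnegative.\<close>
    define q where "q = r + 2 * (x \<bullet> d) - (norm x)\<^sup>2 - m"
    have step: "0 \<le> q + t * (norm (d - x))\<^sup>2" if t: "0 < t" "t \<le> 1" for t
    proof -
      have "m \<le> ((1 - t) * s n + t * r) + (norm ((1 - t) *\<^sub>R c n + t *\<^sub>R d))\<^sup>2" for n
        using convexD[OF cvx K dK, of "1 - t" t n] t by (intro m_le) simp
      moreover have "(\<lambda>n. ((1 - t) * s n + t * r) + (norm ((1 - t) *\<^sub>R c n + t *\<^sub>R d))\<^sup>2)
          \<longlonglongrightarrow> ((1 - t) * (m - (norm x)\<^sup>2) + t * r) + (norm ((1 - t) *\<^sub>R x + t *\<^sub>R d))\<^sup>2"
        by (intro tendsto_intros x s)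
      ultimately have "m \<le> ((1 - t) * (m - (norm x)\<^sup>2) + t * r) + (norm ((1 - t) *\<^sub>R x + t *\<^sub>R d))\<^sup>2"
        by (intro LIMSEQ_le_const) auto
      also have "\<dots> = m + t * (q + t * (norm (d - x))\<^sup>2)"
        unfolding q_def power2_norm_eq_inner
        by (simp add: inner_diff inner_add inner_commute algebra_simps)
      finally have "0 \<le> t * (q + t * (norm (d - x))\<^sup>2)" by simp
      then show ?thesis using t by (simp add: zero_le_mult_iff)
    qed
    have "((\<lambda>t. q + t * (norm (d - x))\<^sup>2) \<longlongrightarrow> q + 0 * (norm (d - x))\<^sup>2) (at_right 0)"
      by (intro tendsto_intros)
    moreover have "eventually (\<lambda>t. 0 \<le> q + t * (norm (d - x))\<^sup>2) (at_right 0)"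
      using step by (auto simp: eventually_at_right_field intro!: exI[of _ 1])
    ultimately have "0 \<le> q"
      using tendsto_lowerbound by fastforce
    then show ?thesis using m_nonneg by (simp add: q_def)
  qed
  then show ?thesis by blast
qed

text \<open>A half-space containing the lifted graph contains its hull, and this is used twice.
  Monotonicity against a fixed \<open>(a, b)\<close> in \<open>G\<close> gives the first half-space;
  the inequality obtained, read as a condition on \<open>(a, b)\<close>, gives the second.\<close>

lemma convex_hull_monotone_graph:
  fixes G :: "('a::real_inner \<times> 'a) set"
  assumes mono: "\<And>y w y' w'. (y, w) \<in> G \<Longrightarrow> (y', w') \<in> G \<Longrightarrow> 0 \<le> (y - y') \<bullet> (w - w')"
    and p: "((y, w), s) \<in> convex hull ((\<lambda>(y, w). ((y, w), y \<bullet> w)) ` G)"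
  shows "y \<bullet> w \<le> s"
proof -
  let ?H = "(\<lambda>(y, w). ((y, w), y \<bullet> w)) ` G"
  have cvx: "convex {p :: ('a \<times> 'a) \<times> real. a \<bullet> snd (fst p) + fst (fst p) \<bullet> b \<le> snd p + k}"
    for a b :: 'a and k
  proof -
    have "convex {p :: ('a \<times> 'a) \<times> real. (- b, - a, 1) \<bullet> (fst (fst p), snd (fst p), snd p) \<ge> - k}"
    proof (rule convexI, goal_cases)
      case (1 p q u v)
      then have "u * ((- b, - a, 1) \<bullet> (fst (fst p), snd (fst p), snd p))
          + v * ((- b, - a, 1) \<bullet> (fst (fst q), snd (fst q), snd q)) \<ge> u * (- k) + v * (- k)"
        by (intro add_mono mult_left_mono) auto
      moreover have "u * (- k) + v * (- k) = - k"
        using 1 by (metis distrib_right mult_1)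
      ultimately show ?case
        by (simp add: inner_add algebra_simps)
    qed
    moreover have "{p :: ('a \<times> 'a) \<times> real. (- b, - a, 1) \<bullet> (fst (fst p), snd (fst p), snd p) \<ge> - k}
      = {p. a \<bullet> snd (fst p) + fst (fst p) \<bullet> b \<le> snd p + k}"
      by (auto simp: inner_commute)
    ultimately show ?thesis by simp
  qed
  have 1: "a \<bullet> w + y \<bullet> b \<le> s + a \<bullet> b" if "(a, b) \<in> G" for a b
  proof -
    have "?H \<subseteq> {p. a \<bullet> snd (fst p) + fst (fst p) \<bullet> b \<le> snd p + a \<bullet> b}"
    proof -
      have "a \<bullet> w' + y' \<bullet> b \<le> y' \<bullet> w' + a \<bullet> b" if "(y', w') \<in> G" for y' w'
        using mono[OF \<open>(a, b) \<in> G\<close> that] by (simp add: inner_diff)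
      then show ?thesis by auto
    qed
    from hull_minimal[of _ _ convex, OF this cvx] p show ?thesis by auto
  qed
  \<comment> \<open>The roles are swapped: the hull point \<open>((y, w), s)\<close> now defines the
    half-space, and turns out to lie in it itself.\<close>
  have "?H \<subseteq> {p. y \<bullet> snd (fst p) + fst (fst p) \<bullet> w \<le> snd p + s}"
    using 1 by (auto simp: algebra_simps)
  from hull_minimal[of _ _ convex, OF this cvx] p have "y \<bullet> w + y \<bullet> w \<le> s + s" by auto
  then show ?thesis by simp
qed

text \<open>With \<open>c = (y - w) / 2\<close> and \<open>s = y \<bullet> w\<close>, the
  variational inequality \<open>0 \<le> s + 2 (x \<bullet> c) - |x|\<^sup>2\<close> is exactly the
  claim. Nonnegativity on the hull holds since
  \<open>y \<bullet> w + |c|\<^sup>2 = |(y + w) / 2|\<^sup>2\<close>.\<close>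

lemma monotone_set_extension:
  fixes G :: "('a::{real_inner, complete_space} \<times> 'a) set"
  assumes ne: "G \<noteq> {}"
    and mono: "\<And>y w y' w'. (y, w) \<in> G \<Longrightarrow> (y', w') \<in> G \<Longrightarrow> 0 \<le> (y - y') \<bullet> (w - w')"
  shows "\<exists>x. \<forall>(y, w) \<in> G. 0 \<le> (x - y) \<bullet> (- x - w)"
proof -
  let ?g = "\<lambda>p :: ('a \<times> 'a) \<times> real. ((1/2) *\<^sub>R (fst (fst p) - snd (fst p)), snd p)"
  let ?H = "(\<lambda>(y, w). ((y, w), y \<bullet> w)) ` G"
  have lin: "linear ?g"
    by (rule linearI) (auto simp: algebra_simps)
  have "convex (?g ` (convex hull ?H))"
    by (intro convex_linear_image lin convex_convex_hull)
  moreover have "?g ` (convex hull ?H) \<noteq> {}" using ne by simp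
  moreover have "0 \<le> s + (norm c)\<^sup>2" if cs: "(c, s) \<in> ?g ` (convex hull ?H)" for c s
  proof -
    from cs obtain y w where yw: "((y, w), s) \<in> convex hull ?H" "c = (1/2) *\<^sub>R (y - w)"
      by auto
    have "y \<bullet> w \<le> s" by (rule convex_hull_monotone_graph[OF mono yw(1)])
    moreover have "y \<bullet> w + (norm c)\<^sup>2 = (norm ((1/2) *\<^sub>R (y + w)))\<^sup>2"
      unfolding yw(2) power2_norm_eq_inner
      by (simp add: inner_diff inner_add inner_commute field_simps)
    ultimately show ?thesis
      by (metis add_right_mono order_trans zero_le_power2)
  qed
  ultimately obtain x
    where x: "\<And>c s. (c, s) \<in> ?g ` (convex hull ?H) \<Longrightarrow> 0 \<le> s + 2 * (x \<bullet> c) - (norm x)\<^sup>2"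
    using convex_min_norm_sq_variational[of "?g ` (convex hull ?H)"] by fast
  have "0 \<le> (x - y) \<bullet> (- x - w)" if "(y, w) \<in> G" for y w
  proof -
    have "((y, w), y \<bullet> w) \<in> convex hull ?H"
      using that by (intro hull_inc) auto
    then have "?g ((y, w), y \<bullet> w) \<in> ?g ` (convex hull ?H)" by (rule imageI)
    then have "0 \<le> y \<bullet> w + 2 * (x \<bullet> ((1/2) *\<^sub>R (y - w))) - (norm x)\<^sup>2"
      by (intro x) simp
    then show ?thesis
      by (simp add: power2_norm_eq_inner inner_diff inner_commute field_simps)
  qed
  then show ?thesis by blast
qed

lemma monotone_opD:
  assumes "monotone_op A" "u \<in> A x" "w \<in> A y"
  shows "0 \<le> (x - y) \<bullet> (u - w)"
  using assms by (auto simp: monotone_op_def graph_def)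

text \<open>Adjoining \<open>(x, u)\<close> to the graph keeps it monotone, so by maximality nothing
  was added.\<close>

lemma maximally_monotone_memI:
  assumes max: "maximally_monotone A"
    and rel: "\<And>y w. w \<in> A y \<Longrightarrow> 0 \<le> (x - y) \<bullet> (u - w)"
  shows "u \<in> A x"
proof -
  have monoA: "monotone_op A"
    and ext: "\<And>B. monotone_op B \<Longrightarrow> graph A \<subseteq> graph B \<Longrightarrow> graph B = graph A"
    using max by (auto simp: maximally_monotone_def)
  define B where "B = A(x := insert u (A x))"
  have G: "graph B = insert (x, u) (graph A)"
    by (auto simp: B_def graph_def split: if_splits)
  have rel': "0 \<le> (y - x) \<bullet> (w - u)" if "w \<in> A y" for y w
    using rel[OF that] by (simp add: inner_diff algebra_simps)
  have "monotone_op B"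
    unfolding monotone_op_def G
    using rel rel' monotone_opD[OF monoA] by (auto simp: graph_def)
  then have "graph B = graph A" by (rule ext) (auto simp: G)
  then have "(x, u) \<in> graph A" using G by blast
  then show ?thesis by (simp add: graph_def)
qed

lemma Minty:
  fixes A :: "'a::{real_inner, complete_space} \<Rightarrow> 'a set"
  assumes max: "maximally_monotone A"
  shows "\<exists>x. u - x \<in> A x"
proof -
  have monoA: "monotone_op A" using max by (simp add: maximally_monotone_def)
  \<comment> \<open>Translating the values by \<open>u\<close> reduces the claim to
    \<open>u = 0\<close>.\<close>
  define G where "G = (\<lambda>(y, w). (y, w - u)) ` graph A"
  have "graph A \<noteq> {}"
  proof
    assume "graph A = {}"
    then have "A y = {}" for y by (auto simp: graph_def)
    \<comment> \<open>Every pair is vacuously related to an empty graph.\<close>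
    then have "0 \<in> A 0" by (intro maximally_monotone_memI[OF max]) auto
    with \<open>graph A = {}\<close> show False by (auto simp: graph_def)
  qed
  then have ne: "G \<noteq> {}" by (simp add: G_def)
  have "0 \<le> (y - y') \<bullet> (w - w')" if "(y, w) \<in> G" "(y', w') \<in> G" for y w y' w'
    using that monotone_opD[OF monoA] by (fastforce simp: G_def graph_def)
  from monotone_set_extension[OF ne this]
  obtain x where x: "\<forall>(y, w) \<in> G. 0 \<le> (x - y) \<bullet> (- x - w)" by blast
  have "0 \<le> (x - y) \<bullet> ((u - x) - w)" if "w \<in> A y" for y w
  proof -
    have "(y, w - u) \<in> G" using that by (force simp: G_def graph_def)
    with x have "0 \<le> (x - y) \<bullet> (- x - (w - u))" by blast
    then show ?thesis by (simp add: algebra_simps)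
  qed
  then have "u - x \<in> A x" by (rule maximally_monotone_memI[OF max])
  then show ?thesis ..
qed

section \<open>Resolvents\<close>

lemma mem_singleton_plus_iff:
  fixes x y :: "'a::ab_group_add"
  shows "x \<in> {y} + S \<longleftrightarrow> x - y \<in> S"
  by (auto simp: set_plus_def intro!: bexI[of _ "x - y"])

lemma resolvent_eqI:
  assumes mono: "monotone_op C" and y: "x - y \<in> C y"
  shows "resolvent C x = y"
  unfolding resolvent_def mem_singleton_plus_iff
proof (rule the_equality, rule y)
  fix z assume "x - z \<in> C z"
  from monotone_opD[OF mono this y] have "(z - y) \<bullet> (z - y) \<le> 0"
    by (simp add: inner_diff algebra_simps)
  then show "z = y" by (metis inner_ge_zero inner_eq_zero_iff order_antisym right_minus_eq)
qed

lemma resolvent_mem: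
  fixes C :: "'a::{real_inner, complete_space} \<Rightarrow> 'a set"
  assumes max: "maximally_monotone C"
  shows "x - resolvent C x \<in> C (resolvent C x)"
proof -
  obtain y where y: "x - y \<in> C y" using Minty[OF max] by blast
  with max have "resolvent C x = y"
    by (intro resolvent_eqI) (simp_all add: maximally_monotone_def)
  with y show ?thesis by simp
qed

text \<open>This is \<open>|2 p - d|\<^sup>2 = |d|\<^sup>2 - 4 (p \<bullet> (d - p))\<close>. For
  maximally monotone \<open>C\<close> the inner product is the monotonicity gap of two graph points:
  its sign gives nonexpansiveness, its size drives the convergence.\<close>

lemma reflected_resolvent_dist_sq:
  "(norm (reflected_resolvent C x - reflected_resolvent C y))\<^sup>2 = (norm (x - y))\<^sup>2
    - 4 * ((resolvent C x - resolvent C y) \<bullet> ((x - resolvent C x) - (y - resolvent C y)))"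
proof -
  define p where "p = resolvent C x - resolvent C y"
  have 1: "reflected_resolvent C x - reflected_resolvent C y = 2 *\<^sub>R p - (x - y)"
    by (simp add: reflected_resolvent_def p_def algebra_simps)
  have 2: "(x - resolvent C x) - (y - resolvent C y) = (x - y) - p"
    by (simp add: p_def)
  show ?thesis
    unfolding 1 2 p_def[symmetric] power2_norm_eq_inner
    by (simp add: inner_diff inner_commute algebra_simps)
qed

lemma reflected_resolvent_nonexpansive:
  fixes C :: "'a::{real_inner, complete_space} \<Rightarrow> 'a set"
  assumes max: "maximally_monotone C"
  shows "norm (reflected_resolvent C x - reflected_resolvent C y) \<le> norm (x - y)"
proof -
  have "monotone_op C" using max by (simp add: maximally_monotone_def)
  from monotone_opD[OF this resolvent_mem[OF max] resolvent_mem[OF max]]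
  have "(norm (reflected_resolvent C x - reflected_resolvent C y))\<^sup>2 \<le> (norm (x - y))\<^sup>2"
    unfolding reflected_resolvent_dist_sq by simp
  then show ?thesis by (simp add: power2_le_iff_abs_le)
qed

section \<open>The minimal displacement vector\<close>

text \<open>Tikhonov regularisation: the point \<open>y\<close> is the displacement at the solution of
  \<open>l x + (x - T x) = 0\<close> for small \<open>l > 0\<close>.\<close>

lemma displacement_approx:
  fixes T :: "'a::{real_inner, complete_space} \<Rightarrow> 'a"
  assumes T: "\<And>x y. norm (T x - T y) \<le> norm (x - y)"
    and e: "0 < e"
  shows "\<exists>y \<in> range (\<lambda>x. x - T x). \<forall>u \<in> {a, b}.
    (norm (y - (u - T u)))\<^sup>2 \<le> (norm (u - T u))\<^sup>2 - (norm y)\<^sup>2 + e"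
proof -
  let ?M = "\<lambda>x. x - T x"
  define S where "S u = 2 * (norm u * (norm (?M 0) + norm (?M u)))" for u
  have S: "0 \<le> S u" for u by (simp add: S_def)
  \<comment> \<open>Small enough for the error terms at both \<open>a\<close> and \<open>b\<close>;
    the \<open>1\<close> keeps the denominator positive.\<close>
  define l where "l = e / (S a + S b + 1)"
  have l: "0 < l" using e S[of a] S[of b] by (simp add: l_def)
  have lS: "l * S u \<le> e" if "u \<in> {a, b}" for u
  proof -
    have "S u \<le> S a + S b + 1" using S[of a] S[of b] that by auto
    then have "e * S u \<le> e * (S a + S b + 1)" using e by simp
    then show ?thesis using S[of a] S[of b] by (simp add: l_def field_simps)
  qed
  have "\<exists>!x. (1 / (1 + l)) *\<^sub>R T x = x"
  proof (rule banach_fix_type[where c = "1 / (1 + l)"])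
    show "\<forall>x y. dist ((1 / (1 + l)) *\<^sub>R T x) ((1 / (1 + l)) *\<^sub>R T y) \<le> 1 / (1 + l) * dist x y"
    proof (intro allI)
      fix x y
      have "dist ((1 / (1 + l)) *\<^sub>R T x) ((1 / (1 + l)) *\<^sub>R T y) = 1 / (1 + l) * norm (T x - T y)"
        using l by (simp add: dist_norm flip: scaleR_diff_right)
      also have "\<dots> \<le> 1 / (1 + l) * dist x y"
        unfolding dist_norm using l by (intro mult_left_mono T) simp
      finally show "dist ((1 / (1 + l)) *\<^sub>R T x) ((1 / (1 + l)) *\<^sub>R T y) \<le> 1 / (1 + l) * dist x y" .
    qed
  qed (use l in auto)
  then obtain x where "(1 / (1 + l)) *\<^sub>R T x = x" by blast
  then have "(1 + l) *\<^sub>R ((1 / (1 + l)) *\<^sub>R T x) = (1 + l) *\<^sub>R x" by simp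
  then have Tx: "T x = (1 + l) *\<^sub>R x" using l by simp
  define y where "y = ?M x"
  have y: "y = - l *\<^sub>R x" by (simp add: y_def Tx algebra_simps)
  \<comment> \<open>Monotonicity of \<open>Id - T\<close> between \<open>x\<close> and
    \<open>u\<close>, multiplied by \<open>l\<close> so that \<open>l x\<close> becomes
    \<open>- y\<close>.\<close>
  have key: "(norm y)\<^sup>2 \<le> y \<bullet> ?M u + l * (norm u * norm (y - ?M u))" for u
  proof -
    have "(x - u) \<bullet> (T x - T u) \<le> norm (x - u) * norm (x - u)"
      using T[of x u] by (meson mult_left_mono norm_cauchy_schwarz norm_ge_zero order_trans)
    then have "(x - u) \<bullet> (T x - T u) \<le> (x - u) \<bullet> (x - u)"
      by (simp flip: power2_norm_eq_inner power2_eq_square)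
    then have "0 \<le> (x - u) \<bullet> (y - ?M u)"
      by (simp add: y_def inner_diff algebra_simps)
    then have "0 \<le> l * ((x - u) \<bullet> (y - ?M u))" using l by simp
    also have "\<dots> = (l *\<^sub>R x) \<bullet> (y - ?M u) + l * (- u \<bullet> (y - ?M u))"
      by (simp add: inner_diff algebra_simps)
    also have "(l *\<^sub>R x) \<bullet> (y - ?M u) = y \<bullet> ?M u - (norm y)\<^sup>2"
      unfolding power2_norm_eq_inner by (simp add: y inner_diff algebra_simps)
    also have "- u \<bullet> (y - ?M u) \<le> norm u * norm (y - ?M u)"
      using norm_cauchy_schwarz[of "- u" "y - ?M u"] by simp
    finally show ?thesis using l by simp
  qed
  \<comment> \<open>At \<open>u = 0\<close> the error term vanishes, which bounds \<open>y\<close>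
    independently of \<open>l\<close>.\<close>
  have "norm y * norm y \<le> norm y * norm (?M 0)"
    using key[of 0] norm_cauchy_schwarz[of y "?M 0"] by (simp add: power2_eq_square)
  then have ny: "norm y \<le> norm (?M 0)"
    by (metis mult_le_cancel_left norm_ge_zero not_le order_trans)
  have "(norm (y - ?M u))\<^sup>2 \<le> (norm (?M u))\<^sup>2 - (norm y)\<^sup>2 + e" if u: "u \<in> {a, b}" for u
  proof -
    have "norm (y - ?M u) \<le> norm (?M 0) + norm (?M u)"
      using norm_triangle_ineq4[of y "?M u"] ny by linarith
    then have "l * (norm u * norm (y - ?M u)) \<le> l * (norm u * (norm (?M 0) + norm (?M u)))"
      using l by (intro mult_left_mono) auto
    also have "\<dots> = l * S u / 2" by (simp add: S_def)
    finally have "2 * (l * (norm u * norm (y - ?M u))) \<le> e" using lS[OF u] by linarith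
    moreover have "(norm (y - ?M u))\<^sup>2 = (norm y)\<^sup>2 - 2 * (y \<bullet> ?M u) + (norm (?M u))\<^sup>2"
      unfolding power2_norm_eq_inner by (simp add: inner_diff inner_commute algebra_simps)
    ultimately show ?thesis using key[of u] by linarith
  qed
  then show ?thesis unfolding y_def by blast
qed

text \<open>This is what is left of the convexity of the closed range: midpoints of displacements have
  norm at least \<open>d\<close>.\<close>

lemma displacement_dist_sq_le:
  fixes T :: "'a::{real_inner, complete_space} \<Rightarrow> 'a"
  assumes T: "\<And>x y. norm (T x - T y) \<le> norm (x - y)"
    and d: "0 \<le> d" "\<And>x. d \<le> norm (x - T x)"
    and p: "p \<in> closure (range (\<lambda>x. x - T x))" and q: "q \<in> closure (range (\<lambda>x. x - T x))"
  shows "(norm (p - q))\<^sup>2 \<le> 2 * (norm p)\<^sup>2 + 2 * (norm q)\<^sup>2 - 4 * d\<^sup>2"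
proof -
  let ?M = "\<lambda>x. x - T x"
  have le: "(norm (?M a - ?M b))\<^sup>2 \<le> 2 * (norm (?M a))\<^sup>2 + 2 * (norm (?M b))\<^sup>2 - 4 * d\<^sup>2" for a b
  proof (rule field_le_epsilon)
    fix e :: real assume "0 < e"
    define k where "k = e / 4"
    have k: "e = 4 * k" "0 < k" using \<open>0 < e\<close> by (simp_all add: k_def)
    obtain y where y: "y \<in> range ?M"
      "\<forall>u \<in> {a, b}. (norm (y - ?M u))\<^sup>2 \<le> (norm (?M u))\<^sup>2 - (norm y)\<^sup>2 + k"
      using displacement_approx[OF T k(2), of a b] by blast
    have "d\<^sup>2 \<le> (norm y)\<^sup>2" using y(1) d by (auto intro!: power_mono)
    \<comment> \<open>Parallelogram law for \<open>y - ?M a\<close> and \<open>y - ?M b\<close>.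
      Each of the two errors \<open>k\<close> is doubled, hence \<open>e = 4 k\<close>.\<close>
    moreover have "(norm (?M a - ?M b))\<^sup>2 + (norm (2 *\<^sub>R y - ?M a - ?M b))\<^sup>2
        = 2 * (norm (y - ?M a))\<^sup>2 + 2 * (norm (y - ?M b))\<^sup>2"
      unfolding power2_norm_eq_inner by (simp add: inner_diff inner_commute algebra_simps)
    moreover have "0 \<le> (norm (2 *\<^sub>R y - ?M a - ?M b))\<^sup>2" by simp
    moreover have "(norm (y - ?M a))\<^sup>2 \<le> (norm (?M a))\<^sup>2 - (norm y)\<^sup>2 + k"
      "(norm (y - ?M b))\<^sup>2 \<le> (norm (?M b))\<^sup>2 - (norm y)\<^sup>2 + k"
      using y(2) by auto
    ultimately show "(norm (?M a - ?M b))\<^sup>2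
        \<le> 2 * (norm (?M a))\<^sup>2 + 2 * (norm (?M b))\<^sup>2 - 4 * d\<^sup>2 + e"
      unfolding k(1) by linarith
  qed
  obtain f where f: "\<And>n. f n \<in> range ?M" "f \<longlonglongrightarrow> p"
    using p unfolding closure_sequential by blast
  obtain g where g: "\<And>n. g n \<in> range ?M" "g \<longlonglongrightarrow> q"
    using q unfolding closure_sequential by blast
  show ?thesis
  proof (rule LIMSEQ_le)
    show "(\<lambda>n. (norm (f n - g n))\<^sup>2) \<longlonglongrightarrow> (norm (p - q))\<^sup>2"
      by (intro tendsto_intros f g)
    show "(\<lambda>n. 2 * (norm (f n))\<^sup>2 + 2 * (norm (g n))\<^sup>2 - 4 * d\<^sup>2)
        \<longlonglongrightarrow> 2 * (norm p)\<^sup>2 + 2 * (norm q)\<^sup>2 - 4 * d\<^sup>2"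
      by (intro tendsto_intros f g)
    have "(norm (f n - g n))\<^sup>2 \<le> 2 * (norm (f n))\<^sup>2 + 2 * (norm (g n))\<^sup>2 - 4 * d\<^sup>2" for n
      using f(1)[of n] g(1)[of n] le by auto
    then show "\<exists>N. \<forall>n\<ge>N. (norm (f n - g n))\<^sup>2 \<le> 2 * (norm (f n))\<^sup>2 + 2 * (norm (g n))\<^sup>2 - 4 * d\<^sup>2"
      by blast
  qed
qed

text \<open>The midpoint bound makes a norm-minimising sequence of displacements Cauchy and its
  limit the only element of least norm in the closure, so the description defining \<open>v\<close>
  is proper.\<close>

lemma minimal_displacement:
  fixes T :: "'a::{real_inner, complete_space} \<Rightarrow> 'a"
  assumes T: "\<And>x y. norm (T x - T y) \<le> norm (x - y)"
    and v: "v = metric_projection (closure (range (\<lambda>x. x - T x))) 0"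
  shows "norm v \<le> norm (x - T x)"
    and "norm (x - T x) \<le> norm v \<Longrightarrow> x - T x = v"
proof -
  let ?M = "\<lambda>x. x - T x"
  let ?D = "closure (range ?M)"
  define d where "d = Inf (norm ` range ?M)"
  have bdd: "bdd_below (norm ` range ?M)" by (rule bdd_belowI[of _ 0]) auto
  have d: "0 \<le> d" unfolding d_def by (rule cINF_greatest) auto
  have d_le: "d \<le> norm (?M x)" for x
    unfolding d_def by (rule cINF_lower[OF bdd]) simp
  have d_le': "d \<le> norm p" if p: "p \<in> ?D" for p
  proof -
    obtain f where f: "\<And>n. f n \<in> range ?M" "f \<longlonglongrightarrow> p"
      using p unfolding closure_sequential by blast
    have "d \<le> norm (f n)" for n using f(1)[of n] d_le by auto
    then show ?thesis by (intro LIMSEQ_le_const[OF tendsto_norm[OF f(2)]]) auto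
  qed
  note dist_le = displacement_dist_sq_le[OF T d d_le]
  obtain f where f: "\<And>n. f n \<in> range ?M" "(\<lambda>n. norm (f n)) \<longlonglongrightarrow> d"
    using minimising_sequence[OF _ bdd] unfolding d_def by blast
  have fD: "f n \<in> ?D" for n using f(1) closure_subset by blast
  have "(\<lambda>n. (norm (f n))\<^sup>2) \<longlonglongrightarrow> d\<^sup>2" by (intro tendsto_intros f)
  then have "Cauchy f" using dist_le[OF fD fD] by (rule Cauchy_of_dist_sq_le)
  then obtain p where p: "f \<longlonglongrightarrow> p"
    using Cauchy_convergent convergent_def by blast
  have pD: "p \<in> ?D" using fD p closed_closure closed_sequentially by blast
  have np: "norm p = d"
    using LIMSEQ_unique[OF tendsto_norm[OF p] f(2)] .
  have uniq: "q = p" if "q \<in> ?D" "norm q \<le> d" for q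
  proof -
    have "norm q = d" using that d_le'[of q] by simp
    then have "(norm (q - p))\<^sup>2 \<le> 0" using dist_le[OF that(1) pD] by (simp add: np)
    then show ?thesis by simp
  qed
  have vp: "v = p"
    unfolding v metric_projection_def
  proof (rule the_equality)
    show "p \<in> ?D \<and> (\<forall>y\<in>?D. dist 0 p \<le> dist 0 y)"
      using pD d_le' by (simp add: np)
    show "q = p" if "q \<in> ?D \<and> (\<forall>y\<in>?D. dist 0 q \<le> dist 0 y)" for q
      using that pD by (intro uniq) (auto simp: np[symmetric])
  qed
  show "norm v \<le> norm (?M x)" using d_le vp np by metis
  show "?M x = v" if "norm (?M x) \<le> norm v"
  proof -
    have "?M x \<in> ?D" by (rule subsetD[OF closure_subset]) (rule rangeI)
    then have "?M x = p" using that np vp by (intro uniq) simp_all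
    with vp show ?thesis by simp
  qed
qed

section \<open>Convergence of the shadow sequence\<close>

text \<open>While \<open>p n\<close> stays at distance at least \<open>e\<close> from
  \<open>q\<close>, the inner product is at least \<open>\<phi> e > 0\<close>. The element
  \<open>b n\<close> of \<open>A q\<close> may vary with \<open>n\<close>, as
  \<open>w n - xbar\<close> does later.\<close>

lemma uniformly_monotone_tendsto:
  fixes p :: "nat \<Rightarrow> 'a::real_inner"
  assumes unif: "uniformly_monotone_with \<phi> A"
    and p: "\<And>n. a n \<in> A (p n)" and q: "\<And>n. b n \<in> A q"
    and lim: "(\<lambda>n. (p n - q) \<bullet> (a n - b n)) \<longlonglongrightarrow> 0"
  shows "p \<longlonglongrightarrow> q"
proof (rule LIMSEQ_I)
  fix e :: real assume e: "0 < e"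
  have mod: "0 \<le> \<phi> e" "\<phi> e \<noteq> 0" "mono_on {0..} \<phi>"
    using unif e unfolding uniformly_monotone_with_def modulus_def by auto
  have le: "\<phi> (norm (p n - q)) \<le> ereal ((p n - q) \<bullet> (a n - b n))" for n
    using unif p q unfolding uniformly_monotone_with_def graph_def by blast
  have "0 < \<phi> e" using mod by simp
  \<comment> \<open>A real threshold is interposed because \<open>\<phi> e\<close> may be
    infinite.\<close>
  then obtain k where k: "0 < k" "ereal k < \<phi> e"
    using ereal_dense2[of 0 "\<phi> e"] by (auto simp: zero_ereal_def)
  obtain N where N: "\<And>n. n \<ge> N \<Longrightarrow> \<bar>(p n - q) \<bullet> (a n - b n)\<bar> < k"
    using LIMSEQ_D[OF lim k(1)] by auto
  have "norm (p n - q) < e" if "n \<ge> N" for n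
  proof (rule ccontr)
    assume "\<not> norm (p n - q) < e"
    then have "\<phi> e \<le> \<phi> (norm (p n - q))"
      using e by (intro mono_onD[OF mod(3)]) auto
    also note le
    also have "ereal ((p n - q) \<bullet> (a n - b n)) < ereal k" using N[OF that] by simp
    finally show False using k(2) by simp
  qed
  then show "\<exists>N. \<forall>n\<ge>N. norm (p n - q) < e" by blast
qed

theorem theorem4p3:
  fixes A B :: "'a::{real_inner, complete_space} \<Rightarrow> 'a set"
    and T Tt :: "'a \<Rightarrow> 'a" and v :: 'a and Z :: "'a set" and \<phi> :: "real \<Rightarrow> ereal"
  assumes maxA: "maximally_monotone A"
    and maxB: "maximally_monotone B"
    and Tt: "Tt = reflected_resolvent B \<circ> reflected_resolvent A"
    and T: "T = (\<lambda>x. (1/2) *\<^sub>R (x + reflected_resolvent B (reflected_resolvent A x)))"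
    and v: "v = metric_projection (closure (range (\<lambda>x. x - T x))) 0"
    and Z: "Z = {x. 0 \<in> {- v} + A x + B (x - v)}"
    and Z_nonempty: "Z \<noteq> {}"
    and unif: "uniformly_monotone_with \<phi> A"
    and super: "supercoercive \<phi>"
  shows "\<exists>xbar. Z = {xbar} \<and> (\<forall>x. (\<lambda>n. resolvent A ((Tt ^^ n) x)) \<longlonglongrightarrow> xbar)"
proof -
  have monoA: "monotone_op A" and monoB: "monotone_op B"
    using maxA maxB by (auto simp: maximally_monotone_def)
  let ?J = "resolvent A"
  let ?RA = "reflected_resolvent A" and ?RB = "reflected_resolvent B"
  have JA: "x - ?J x \<in> A (?J x)" for x by (rule resolvent_mem[OF maxA])
  have Z_iff: "z \<in> Z \<longleftrightarrow> (\<exists>a \<in> A z. v - a \<in> B (z - v))" for z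
  proof -
    have "0 \<in> {- v} + A z + B (z - v) \<longleftrightarrow> v \<in> A z + B (z - v)"
      by (simp add: add.assoc mem_singleton_plus_iff)
    also have "\<dots> \<longleftrightarrow> (\<exists>a \<in> A z. v - a \<in> B (z - v))"
      by (force simp: set_plus_def)
    finally show ?thesis by (simp add: Z)
  qed
  have sing: "z = z'" if z: "z \<in> Z" and z': "z' \<in> Z" for z z'
  proof -
    obtain a a' where a: "a \<in> A z" "v - a \<in> B (z - v)" "a' \<in> A z'" "v - a' \<in> B (z' - v)"
      using z z' by (auto simp: Z_iff)
    \<comment> \<open>The differences of the \<open>A\<close>-values and of the
      \<open>B\<close>-values are opposite, so the two monotonicity inequalities force
      equality.\<close>
    have "(z - z') \<bullet> (a - a') = 0"
      using monotone_opD[OF monoA a(1,3)] monotone_opD[OF monoB a(2,4)]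
      by (simp add: inner_diff algebra_simps)
    then have "(\<lambda>n::nat. z) \<longlonglongrightarrow> z'"
      using a by (intro uniformly_monotone_tendsto[OF unif, of "\<lambda>_. a" _ "\<lambda>_. a'"]) auto
    then show ?thesis by (simp add: LIMSEQ_const_iff)
  qed
  have Tt_apply: "Tt x = ?RB (?RA x)" for x by (simp add: Tt)
  have Tt_ne: "norm (Tt x - Tt y) \<le> norm (?RA x - ?RA y)" for x y
    unfolding Tt_apply by (rule reflected_resolvent_nonexpansive[OF maxB])
  have Tt_ne': "norm (Tt x - Tt y) \<le> norm (x - y)" for x y
    using Tt_ne reflected_resolvent_nonexpansive[OF maxA] order_trans by blast
  \<comment> \<open>Displacement \<open>v\<close> under \<open>T\<close> is displacement
    \<open>2 v\<close> under \<open>Tt\<close>.\<close>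
  have disp: "x - T x = (1/2) *\<^sub>R (x - Tt x)" for x
    by (simp add: T Tt_apply algebra_simps flip: scaleR_2)
  have T_ne: "norm (T x - T y) \<le> norm (x - y)" for x y
  proof -
    have "norm (T x - T y) = norm ((x - y) + (Tt x - Tt y)) / 2"
      by (simp add: T Tt_apply add_diff_add flip: scaleR_diff_right)
    then show ?thesis
      using norm_triangle_ineq[of "x - y" "Tt x - Tt y"] Tt_ne'[of x y] by linarith
  qed
  have shift: "Tt (x - 2 *\<^sub>R v) = x - 2 *\<^sub>R v - 2 *\<^sub>R v" if x: "Tt x = x - 2 *\<^sub>R v" for x
  proof -
    let ?y = "x - 2 *\<^sub>R v"
    \<comment> \<open>Since \<open>?y = Tt x\<close>, nonexpansiveness bounds its displacement by
      that of \<open>x\<close>, which is already minimal.\<close>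
    have "norm (?y - T ?y) \<le> norm v"
      using Tt_ne'[of x ?y] by (simp add: disp x)
    then have "?y - T ?y = v" by (rule minimal_displacement(2)[OF T_ne v])
    then have "2 *\<^sub>R (?y - T ?y) = 2 *\<^sub>R v" by simp
    then show ?thesis by (simp add: disp algebra_simps)
  qed
  obtain xbar where xbar: "xbar \<in> Z" using Z_nonempty by blast
  have Zeq: "Z = {xbar}" using xbar sing by blast
  have J_fix: "?J x = xbar" if x: "Tt x = x - 2 *\<^sub>R v" for x
  proof -
    \<comment> \<open>Cancelling \<open>x\<close> leaves the \<open>B\<close>-resolvent at
      \<open>?J x - v\<close>, so \<open>x - ?J x\<close> witnesses that \<open>?J x\<close> lies in
      \<open>Z\<close>.\<close>
    have "2 *\<^sub>R resolvent B (?RA x) = 2 *\<^sub>R (?J x - v)"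
      using x by (simp add: Tt_apply reflected_resolvent_def algebra_simps)
    then have "resolvent B (?RA x) = ?J x - v" by simp
    then have "?RA x - (?J x - v) \<in> B (?J x - v)"
      using resolvent_mem[OF maxB, of "?RA x"] by simp
    moreover have "?RA x - (?J x - v) = v - (x - ?J x)"
      by (simp add: reflected_resolvent_def scaleR_2)
    ultimately have "?J x \<in> Z" using JA[of x] by (auto simp: Z_iff)
    then show ?thesis by (simp add: Zeq)
  qed
  obtain a where a: "a \<in> A xbar" "v - a \<in> B (xbar - v)" using xbar by (auto simp: Z_iff)
  define w where "w n = xbar + a - (2 * real n) *\<^sub>R v" for n
  have w_Suc: "w (Suc n) = w n - 2 *\<^sub>R v" for n by (simp add: w_def algebra_simps)
  have Tt_w: "Tt (w n) = w n - 2 *\<^sub>R v" for n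
  proof (induction n)
    case 0
    have "?J (w 0) = xbar" using a by (intro resolvent_eqI[OF monoA]) (simp add: w_def)
    then have RA: "?RA (w 0) = xbar - a"
      by (simp add: reflected_resolvent_def w_def scaleR_2)
    have "resolvent B (xbar - a) = xbar - v"
      using a by (intro resolvent_eqI[OF monoB]) simp
    then show ?case
      unfolding Tt_apply RA by (simp add: reflected_resolvent_def w_def scaleR_2)
  next
    case (Suc n)
    then show ?case unfolding w_Suc by (rule shift)
  qed
  have J_w: "?J (w n) = xbar" for n by (rule J_fix[OF Tt_w])
  have "(\<lambda>n. ?J ((Tt ^^ n) x)) \<longlonglongrightarrow> xbar" for x
  proof -
    define y where "y n = (Tt ^^ n) x" for n
    define D where "D n = (norm (y n - w n))\<^sup>2" for n
    \<comment> \<open>The monotonicity gap of \<open>A\<close> between the points produced by the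
      two orbits; \<open>?RA\<close> lowers the squared distance by exactly \<open>4 r n\<close>,
      and \<open>?RB\<close> does not raise it.\<close>
    define r where "r n = (?J (y n) - xbar) \<bullet> ((y n - ?J (y n)) - (w n - xbar))" for n
    have b: "w n - xbar \<in> A xbar" for n using JA[of "w n"] by (simp add: J_w)
    have r: "0 \<le> r n" for n
      unfolding r_def by (rule monotone_opD[OF monoA JA b])
    have step: "D (Suc n) \<le> D n - 4 * r n" for n
    proof -
      have "D (Suc n) = (norm (Tt (y n) - Tt (w n)))\<^sup>2"
        by (simp add: D_def y_def w_Suc Tt_w)
      also have "\<dots> \<le> (norm (?RA (y n) - ?RA (w n)))\<^sup>2"
        by (intro power_mono Tt_ne) simp
      also have "\<dots> = D n - 4 * r n"
        unfolding reflected_resolvent_dist_sq by (simp add: D_def r_def J_w)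
      finally show ?thesis .
    qed
    have "decseq D"
      using order_trans[OF step] r by (intro decseq_SucI) simp
    moreover have "0 \<le> D n" for n by (simp add: D_def)
    ultimately obtain L where L: "D \<longlonglongrightarrow> L" using decseq_convergent by metis
    \<comment> \<open>Consecutive differences of the convergent \<open>D\<close> vanish in the limit
      and dominate \<open>r\<close>.\<close>
    have "(\<lambda>n. (D n - D (Suc n)) / 4) \<longlonglongrightarrow> (L - L) / 4"
      by (intro tendsto_intros L LIMSEQ_Suc) simp
    then have "(\<lambda>n. (D n - D (Suc n)) / 4) \<longlonglongrightarrow> 0" by simp
    moreover have "r n \<le> (D n - D (Suc n)) / 4" for n using step[of n] by (simp add: field_simps)
    ultimately have "r \<longlonglongrightarrow> 0"
      using r by (intro tendsto_sandwich[of "\<lambda>_. 0" r sequentially "\<lambda>n. (D n - D (Suc n)) / 4"]) auto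
    then have "(\<lambda>n. ?J (y n)) \<longlonglongrightarrow> xbar"
      unfolding r_def by (rule uniformly_monotone_tendsto[OF unif JA b])
    then show ?thesis by (simp add: y_def)
  qed
  then show ?thesis using Zeq by blast
qed

end
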